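(* Let $2\leq n<\omega$ and let $f:[\omega_n]^{<\omega}\to\omega$ be any function. Then there exists a finite set $s\in[\omega_n]^{<\omega}$ and at least $2^n-1$ distinct unordered pairs $\{x,y\}$ of finite sets with $x\neq y$, $x\cup y=s$ and $f(x)=f(y)$.
   Context: $\omega_n$ is the $n$-th uncountable initial ordinal (identified with the set of smaller ordinals), $[\omega_n]^{<\omega}$ is the set of finite subsets of $\omega_n$, and $\omega$ is the set of natural numbers. *)

theory Defs
  imports Main
begin

unbundle cardinal_syntax

text \<open>
  \<open>is_omega n r\<close> says that the well-order \<open>r\<close> is (order isomorphic to) the initial ordinal
  \<open>\<omega>\<^sub>n\<close>, with \<open>\<omega>\<^sub>0 = \<omega>\<close>; \<open>Field r\<close> then plays the role of the set of ordinals below \<open>\<omega>\<^sub>n\<close>.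
  No single HOL type provably carries all the \<open>\<omega>\<^sub>n\<close> at once, hence a predicate rather than a
  function of \<open>n\<close>.  Since \<open>\<omega>\<^sub>n\<close> embeds into \<open>\<omega>\<^bsub>n+1\<^esub>\<close>, taking the predecessor on the same type
  is no restriction: \<open>is_omega_ordIso\<close> shows that the predicate does not depend on the type, and
  \<open>is_omega_unique\<close>, \<open>is_omega_0_ex\<close> and \<open>is_omega_Suc_ex\<close> that it determines \<open>r\<close> up to
  isomorphism and is satisfiable for every \<open>n\<close> on the \<open>n\<close>-fold iterated powerset type over \<open>nat\<close>.
\<close>

primrec is_omega :: "nat \<Rightarrow> 'a rel \<Rightarrow> bool" where
  "is_omega 0 r \<longleftrightarrow> r =o natLeq"
| "is_omega (Suc n) r \<longleftrightarrow> (\<exists>r' :: 'a rel. is_omega n r' \<and> r =o cardSuc r')"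

lemma is_omega_Card_order:
  fixes r :: "'a rel"
  shows "is_omega n r \<Longrightarrow> Card_order r"
proof (induction n arbitrary: r)
  case 0
  then show ?case
    using natLeq_Card_order Card_order_ordIso by auto
next
  case (Suc n)
  then obtain r' :: "'a rel" where "is_omega n r'" "r =o cardSuc r'"
    by auto
  then show ?case
    using Suc.IH cardSuc_Card_order Card_order_ordIso by blast
qed

lemma is_omega_unique:
  fixes r :: "'a rel" and r' :: "'b rel"
  assumes "is_omega n r" "is_omega n r'"
  shows "r =o r'"
  using assms
proof (induction n arbitrary: r r')
  case 0
  then show ?case
    unfolding is_omega.simps by (rule ordIso_transitive[OF _ ordIso_symmetric])
next
  case (Suc n)
  obtain p :: "'a rel" where p: "is_omega n p" "r =o cardSuc p"
    using Suc.prems by auto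
  obtain p' :: "'b rel" where p': "is_omega n p'" "r' =o cardSuc p'"
    using Suc.prems by auto
  have "cardSuc p =o cardSuc p'"
    using Suc.IH[OF p(1) p'(1)] cardSuc_invar_ordIso[OF is_omega_Card_order is_omega_Card_order,
        OF p(1) p'(1)] by blast
  then show ?case
    using ordIso_transitive[OF ordIso_transitive[OF p(2)] ordIso_symmetric[OF p'(2)]] by blast
qed

lemma ordLeq_copy:
  fixes r :: "'a rel" and r' :: "'b rel"
  assumes "r \<le>o r'"
  obtains p :: "'b rel" where "r =o p"
proof -
  from assms obtain f where "embed r r' f" and wr: "Well_order r"
    unfolding ordLeq_def by blast
  then have "inj_on f (Field r)"
    using embed_inj_on by blast
  then have "r =o dir_image r f"
    using dir_image_ordIso wr by blast
  then show ?thesis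
    using that by blast
qed

lemma is_omega_ordIso:
  fixes r :: "'a rel" and r' :: "'b rel"
  assumes "is_omega n r" "r =o r'"
  shows "is_omega n r'"
  using assms
proof (induction n arbitrary: r r')
  case 0
  then show ?case
    unfolding is_omega.simps by (rule ordIso_transitive[OF ordIso_symmetric, rotated])
next
  case (Suc n)
  obtain p :: "'a rel" where p: "is_omega n p" "r =o cardSuc p"
    using Suc.prems by auto
  have co: "Card_order p"
    using p(1) is_omega_Card_order by blast
  have r': "r' =o cardSuc p"
    using ordIso_transitive[OF ordIso_symmetric[OF Suc.prems(2)] p(2)] .
  have "p \<le>o r'"
    using ordLeq_ordIso_trans[OF cardSuc_ordLeq[OF co] ordIso_symmetric[OF r']] .
  then obtain p' :: "'b rel" where p': "p =o p'"
    using ordLeq_copy by blast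
  have om: "is_omega n p'"
    using Suc.IH[OF p(1) p'] .
  have "cardSuc p =o cardSuc p'"
    using cardSuc_invar_ordIso[OF co is_omega_Card_order[OF om]] p' by blast
  then show ?case
    using om ordIso_transitive[OF r'] by auto
qed

lemma is_omega_0_ex: "is_omega 0 natLeq"
  using natLeq_Well_order ordIso_reflexive by auto

lemma is_omega_Suc_ex:
  fixes r :: "'a rel"
  assumes "is_omega n r"
  shows "is_omega (Suc n) (cardSuc r)"
proof -
  have co: "Card_order r"
    using assms is_omega_Card_order by blast
  obtain p :: "'a set rel" where p: "r =o p"
    using ordLeq_copy[OF cardSuc_ordLeq[OF co]] by blast
  have om: "is_omega n p"
    using is_omega_ordIso[OF assms p] .
  have "cardSuc r =o cardSuc p"
    using cardSuc_invar_ordIso[OF co is_omega_Card_order[OF om]] p by blast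
  then show ?thesis
    using om by auto
qed

end

theory Submission
  imports Defs "HOL-Algebra.Free_Abelian_Groups"
begin

text \<open>
  Induction on \<open>n\<close>. Split \<open>\<omega>\<^sub>n\<close> into a set \<open>A\<close> of size \<open>\<aleph>\<^bsub>n-1\<^esub>\<close> and the rest. For each \<open>b\<close> outside \<open>A\<close>
  the induction hypothesis for the colouring \<open>x \<mapsto> f (x \<union> {b})\<close> yields a finite \<open>S \<subseteq> A\<close>. There are
  only \<open>\<aleph>\<^bsub>n-1\<^esub>\<close> possibilities for \<open>S\<close> together with the restriction of that colouring to the subsets
  of \<open>S\<close>, so two elements \<open>b \<noteq> c\<close> share both. In \<open>S \<union> {b, c}\<close> every pair \<open>{x, y}\<close> for \<open>S\<close> gives the
  two pairs \<open>{x \<union> {b}, y \<union> {c}}\<close> and \<open>{x \<union> {c}, y \<union> {b}}\<close>, and \<open>{S \<union> {b}, S \<union> {c}}\<close> is a further one.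
  This is the recursion \<open>a\<^sub>n = 2 a\<^bsub>n-1\<^esub> + 1\<close>, with \<open>a\<^sub>0 = 0\<close>.
\<close>

text \<open>Ordered pairs make lifting decompositions a matter of injective maps. Since
  \<open>x \<noteq> y\<close>, each unordered pair is counted twice.\<close>

definition mono_decomps :: "('a set \<Rightarrow> 'b) \<Rightarrow> 'a set \<Rightarrow> ('a set \<times> 'a set) set" where
  "mono_decomps f s = {(x, y). x \<noteq> y \<and> x \<union> y = s \<and> f x = f y}"

lemma finite_mono_decomps:
  assumes "finite s"
  shows "finite (mono_decomps f s)"
proof (rule finite_subset)
  show "mono_decomps f s \<subseteq> Pow s \<times> Pow s"
    by (auto simp: mono_decomps_def)
qed (use assms in simp)

text \<open>The recursion \<open>2 * a + 1\<close> doubled, as ordered pairs are counted: two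
  disjoint injective copies of the decompositions of \<open>S\<close>, and one new pair in both
  orders.\<close>

lemma card_mono_decomps_step:
  assumes "finite S" "b \<notin> S" "c \<notin> S" "b \<noteq> c"
    and same: "\<And>x. x \<subseteq> S \<Longrightarrow> f (insert b x) = f (insert c x)"
  shows "2 * card (mono_decomps (\<lambda>x. f (insert b x)) S) + 2
    \<le> card (mono_decomps f (insert b (insert c S)))"
proof -
  define D where "D = mono_decomps (\<lambda>x. f (insert b x)) S"
  define h where "h b c = (\<lambda>(x, y). (insert b x, insert c y))" for b c :: 'a
  define E where "E = {(insert b S, insert c S), (insert c S, insert b S)}"
  have D: "x \<subseteq> S" "y \<subseteq> S" "x \<noteq> y" "x \<union> y = S" "f (insert b x) = f (insert b y)"
    if "(x, y) \<in> D" for x y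
    using that by (auto simp: D_def mono_decomps_def)
  have finD: "finite D"
    unfolding D_def by (rule finite_mono_decomps[OF assms(1)])
  have insert_S: "insert d x = insert d y \<longleftrightarrow> x = y"
    if "x \<subseteq> S" "y \<subseteq> S" "d \<notin> S" for x y d
    using that by (metis insert_ident subsetD)
  have "inj_on (h d e) D" if "d \<notin> S" "e \<notin> S" for d e
    using that D(1,2) insert_S by (auto simp: inj_on_def h_def)
  then have card_h: "card (h b c ` D) = card D" "card (h c b ` D) = card D"
    using assms by (simp_all add: card_image)
  \<comment> \<open>Membership of \<open>b\<close> in the first component tells the two copies
    apart.\<close>
  have b_left: "b \<in> fst p" if "p \<in> h b c ` D" for p
    using that by (auto simp: h_def)
  have b_not_left: "b \<notin> fst p" if "p \<in> h c b ` D" for p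
    using that assms(2,4) D(1) by (fastforce simp: h_def)
  have disj1: "h b c ` D \<inter> h c b ` D = {}"
    using b_left b_not_left by blast
  have neq: "insert d S \<noteq> insert e S" if "d \<noteq> e" "d \<notin> S" for d e
    using that by blast
  \<comment> \<open>A pair in \<open>E\<close> could only be lifted from \<open>(S, S)\<close>,
    which is not in \<open>D\<close> because its components are equal.\<close>
  have notin: "(insert d S, insert e S) \<notin> h d' e' ` D"
    if "{d, e} = {b, c}" "{d', e'} = {b, c}" for d e d' e'
  proof
    assume "(insert d S, insert e S) \<in> h d' e' ` D"
    then obtain x y where xy: "(x, y) \<in> D" "insert d S = insert d' x" "insert e S = insert e' y"
      by (auto simp: h_def)
    have nin: "d \<notin> S" "e \<notin> S" "d' \<notin> S" "e' \<notin> S"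
      using that assms by (auto simp: doubleton_eq_iff)
    have "d = d'"
      using insertI1[of d S] D(1)[OF xy(1)] nin(1) unfolding xy(2) by blast
    moreover have "e = e'"
      using insertI1[of e S] D(2)[OF xy(1)] nin(2) unfolding xy(3) by blast
    ultimately have "x = S" "y = S"
      using xy(2,3) D(1,2)[OF xy(1)] nin insert_S by simp_all
    then show False
      using D(3)[OF xy(1)] by simp
  qed
  have disj2: "(h b c ` D \<union> h c b ` D) \<inter> E = {}"
    unfolding E_def
    using notin[of b c b c] notin[of b c c b] notin[of c b b c] notin[of c b c b]
    by (simp add: insert_commute)
  have E: "finite E" "card E = 2"
    using neq[OF assms(4,2)] by (auto simp: E_def)
  have "h b c ` D \<union> h c b ` D \<union> E \<subseteq> mono_decomps f (insert b (insert c S))"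
  proof -
    have "h b c ` D \<subseteq> mono_decomps f (insert b (insert c S))"
    proof
      fix p assume "p \<in> h b c ` D"
      then obtain x y where xy: "(x, y) \<in> D" "p = (insert b x, insert c y)"
        by (auto simp: h_def)
      have "insert b x \<noteq> insert c y"
        using assms D(1,2)[OF xy(1)] by blast
      moreover have "insert b x \<union> insert c y = insert b (insert c S)"
        using D(4)[OF xy(1)] by blast
      moreover have "f (insert b x) = f (insert c y)"
        using D(2,5)[OF xy(1)] same by metis
      ultimately show "p \<in> mono_decomps f (insert b (insert c S))"
        unfolding xy mono_decomps_def mem_Collect_eq prod.case by (intro conjI)
    qed
    moreover have "h c b ` D \<subseteq> mono_decomps f (insert b (insert c S))"
    proof
      fix p assume "p \<in> h c b ` D"
      then obtain x y where xy: "(x, y) \<in> D" "p = (insert c x, insert b y)"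
        by (auto simp: h_def)
      have "insert c x \<noteq> insert b y"
        using assms D(1,2)[OF xy(1)] by blast
      moreover have "insert c x \<union> insert b y = insert b (insert c S)"
        using D(4)[OF xy(1)] by blast
      moreover have "f (insert c x) = f (insert b y)"
        using D(1,5)[OF xy(1)] same by metis
      ultimately show "p \<in> mono_decomps f (insert b (insert c S))"
        unfolding xy mono_decomps_def mem_Collect_eq prod.case by (intro conjI)
    qed
    moreover have "E \<subseteq> mono_decomps f (insert b (insert c S))"
      using same[of S] neq[OF assms(4,2)] by (auto simp: E_def mono_decomps_def)
    ultimately show ?thesis
      by blast
  qed
  then have "card (h b c ` D \<union> h c b ` D \<union> E) \<le> card (mono_decomps f (insert b (insert c S)))"
    by (rule card_mono[OF finite_mono_decomps, rotated]) (use assms in simp)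
  moreover have "card (h b c ` D \<union> h c b ` D \<union> E) = card D + card D + 2"
    using card_Un_disjoint[OF _ E(1) disj2] card_Un_disjoint[OF _ _ disj1] finD E(2) card_h by simp
  ultimately show ?thesis
    by (simp add: D_def)
qed

lemma is_omega_infinite_Field:
  fixes r :: "'a rel"
  assumes "is_omega n r"
  shows "infinite (Field r)"
  using assms
proof (induction n arbitrary: r)
  case 0
  then have "|Field r| =o natLeq"
    using card_of_Field_ordIso[OF is_omega_Card_order[OF 0]] ordIso_transitive by auto
  then show ?case
    using infinite_iff_natLeq_ordLeq ordIso_iff_ordLeq by blast
next
  case (Suc n)
  then obtain r' :: "'a rel" where r': "is_omega n r'" "r =o cardSuc r'"
    by auto
  have "infinite (Field (cardSuc r'))"
    using Suc.IH[OF r'(1)] cardSuc_finite[OF is_omega_Card_order[OF r'(1)]] by blast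
  then show ?case
    using card_of_ordIso_finite_Field[OF is_omega_Card_order[OF Suc.prems]] r'(2)
      card_of_Field_ordIso[OF cardSuc_Card_order[OF is_omega_Card_order[OF r'(1)]]]
      ordIso_transitive ordIso_symmetric by blast
qed

text \<open>Stated for any large enough \<open>X\<close> instead of \<open>Field r\<close>, so that
  the induction hypothesis applies to a subset of \<open>X\<close>. Adding 2 on the right avoids
  subtraction; for \<open>n = 0\<close> the empty set suffices, with no pairs at all.\<close>

lemma many_mono_decomps:
  fixes r :: "'a rel" and f :: "'a set \<Rightarrow> nat"
  assumes "is_omega n r" "r \<le>o |X :: 'a set|"
  shows "\<exists>s \<in> Fpow X. 2 * 2 ^ n \<le> card (mono_decomps f s) + 2"
  using assms
proof (induction n arbitrary: r X f)
  case 0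
  show ?case
    by (rule bexI[of _ "{}"]) (simp_all add: empty_in_Fpow)
next
  case (Suc n)
  obtain r' :: "'a rel" where r': "is_omega n r'" "r =o cardSuc r'"
    using Suc.prems by auto
  note co = is_omega_Card_order[OF r'(1)]
  have "cardSuc r' \<le>o |X|"
    using ordIso_ordLeq_trans[OF ordIso_symmetric[OF r'(2)] Suc.prems(2)] .
  then have less: "r' <o |X|"
    using cardSuc_ordLess_ordLeq[OF co card_of_Card_order] by blast
  have "|Field r'| <o |X|"
    using ordIso_ordLess_trans[OF card_of_Field_ordIso[OF co] less] .
  then have "|Field r'| \<le>o |X|"
    by (rule ordLess_imp_ordLeq)
  \<comment> \<open>\<open>A\<close> is large enough for the induction hypothesis, yet small enough
    that its complement in \<open>X\<close> is strictly larger.\<close>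
  then obtain A where A: "A \<subseteq> X" "|Field r'| =o |A|"
    using internalize_card_of_ordLeq[of "Field r'" "|X|"] by auto
  have AX: "|A| <o |X|"
    using ordIso_ordLess_trans[OF ordIso_symmetric[OF A(2)]] \<open>|Field r'| <o |X|\<close> by blast
  have infA: "infinite A"
    using is_omega_infinite_Field[OF r'(1)] card_of_ordIso_finite[OF A(2)] by blast
  have infX: "infinite X"
    using infA A(1) finite_subset by blast
  have AXA: "|A| <o |X - A|"
    using ordLess_ordIso_trans[OF AX ordIso_symmetric[OF card_of_Un_diff_infinite[OF infX AX]]] .
  have "r' \<le>o |A|"
    using ordIso_transitive[OF ordIso_symmetric[OF card_of_Field_ordIso[OF co]] A(2)]
    by (simp add: ordIso_iff_ordLeq)
  then have "\<exists>s \<in> Fpow A. 2 * 2 ^ n \<le> card (mono_decomps (\<lambda>x. f (insert b x)) s) + 2" for b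
    using Suc.IH[OF r'(1)] by blast
  then obtain S where S: "S b \<in> Fpow A"
    "2 * 2 ^ n \<le> card (mono_decomps (\<lambda>x. f (insert b x)) (S b)) + 2" for b
    by metis
  \<comment> \<open>The restricted colouring is stored as its graph, a finite set, so that all codes
    lie in a set built from \<open>A\<close> and the naturals by \<open>Fpow\<close> and products.
    As \<open>A\<close> is infinite, that set is no larger than \<open>A\<close>.\<close>
  define code where "code b = (S b, (\<lambda>x. (x, f (insert b x))) ` Pow (S b))" for b
  have FA: "|Fpow A| =o |A|"
    by (rule card_of_Fpow_infinite[OF infA])
  have infFA: "infinite (Fpow A \<times> (UNIV :: nat set))"
    using Fpow_not_empty[of A] by (auto dest: finite_cartesian_productD2)
  have "|Fpow A \<times> (UNIV :: nat set)| \<le>o |A|"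
    using infA FA infinite_iff_card_of_nat[of A]
    by (intro card_of_Times_ordLeq_infinite) (auto simp: ordIso_iff_ordLeq)
  then have "|Fpow (Fpow A \<times> (UNIV :: nat set))| \<le>o |A|"
    using card_of_Fpow_infinite[OF infFA] ordIso_ordLeq_trans by blast
  then have "|Fpow A \<times> Fpow (Fpow A \<times> (UNIV :: nat set))| \<le>o |A|"
    using infA FA by (intro card_of_Times_ordLeq_infinite) (auto simp: ordIso_iff_ordLeq)
  then have "|Fpow A \<times> Fpow (Fpow A \<times> (UNIV :: nat set))| <o |X - A|"
    using ordLeq_ordLess_trans AXA by blast
  \<comment> \<open>Pigeonhole: there are fewer codes than elements of \<open>X - A\<close>.\<close>
  then have "\<not> (inj_on code (X - A) \<and> code ` (X - A) \<subseteq> Fpow A \<times> Fpow (Fpow A \<times> UNIV))"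
    using card_of_ordLess by blast
  moreover have "code b \<in> Fpow A \<times> Fpow (Fpow A \<times> UNIV)" for b
    using S(1)[of b] by (auto simp: code_def Fpow_def dest: finite_subset)
  ultimately obtain b c where bc: "b \<in> X - A" "c \<in> X - A" "b \<noteq> c" "code b = code c"
    unfolding inj_on_def by blast
  have same: "f (insert b x) = f (insert c x)" if "x \<subseteq> S b" for x
  proof -
    \<comment> \<open>A pair in the graph stored for \<open>c\<close> with first entry
      \<open>x\<close> must have second entry \<open>f (insert c x)\<close>.\<close>
    have "(x, f (insert b x)) \<in> snd (code c)"
      using that unfolding bc(4)[symmetric] by (auto simp: code_def)
    then show ?thesis
      by (auto simp: code_def)
  qed
  have fin: "finite (S b)" and sub: "S b \<subseteq> A"
    using S(1)[of b] by (auto simp: Fpow_def)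
  have "2 * card (mono_decomps (\<lambda>x. f (insert b x)) (S b)) + 2
      \<le> card (mono_decomps f (insert b (insert c (S b))))"
    using bc sub fin same by (intro card_mono_decomps_step) auto
  then have "2 * 2 ^ Suc n \<le> card (mono_decomps f (insert b (insert c (S b)))) + 2"
    using S(2)[of b] by simp
  moreover have "insert b (insert c (S b)) \<in> Fpow X"
    using bc fin sub A(1) by (auto simp: Fpow_def)
  ultimately show ?case
    by blast
qed

text \<open>Forgetting the order is at most two-to-one: a fibre contains at most a pair and its
  swap.\<close>

lemma card_mono_decomps_le_unordered:
  assumes "finite s"
  shows "card (mono_decomps f s) \<le> 2 * card {{x, y} | x y. x \<noteq> y \<and> x \<union> y = s \<and> f x = f y}"
proof -
  let ?D = "mono_decomps f s"
  define F where "F q = {q, prod.swap q}" for q :: "'a set \<times> 'a set"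
  define u where "u q = {fst q, snd q}" for q :: "'a set \<times> 'a set"
  have fin: "finite ?D"
    by (rule finite_mono_decomps[OF assms])
  have fibre: "card {q \<in> ?D. u q = p} \<le> 2" if "p \<in> u ` ?D" for p
  proof -
    obtain q where "p = u q"
      using \<open>p \<in> u ` ?D\<close> by (rule imageE)
    then have sub: "{q \<in> ?D. u q = p} \<subseteq> F q"
      by (auto simp: F_def u_def doubleton_eq_iff prod_eq_iff)
    have "card {q \<in> ?D. u q = p} \<le> card (F q)"
      by (rule card_mono[OF _ sub]) (simp add: F_def)
    also have "card (F q) \<le> 2"
      by (simp add: F_def card_insert_if)
    finally show "card {q \<in> ?D. u q = p} \<le> 2" .
  qed
  have "?D = (\<Union>p\<in>u ` ?D. {q \<in> ?D. u q = p})"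
    by blast
  then have "card ?D \<le> (\<Sum>p\<in>u ` ?D. card {q \<in> ?D. u q = p})"
    using card_UN_le[OF finite_imageI[OF fin], of "\<lambda>p. {q \<in> ?D. u q = p}" u] by simp
  also have "\<dots> \<le> (\<Sum>p\<in>u ` ?D. 2)"
    by (rule sum_mono) (rule fibre)
  finally have "card ?D \<le> 2 * card (u ` ?D)"
    by simp
  moreover have "u ` ?D = {{x, y} | x y. x \<noteq> y \<and> x \<union> y = s \<and> f x = f y}"
    unfolding mono_decomps_def u_def image_def by (simp add: conj_ac)
  ultimately show ?thesis
    by simp
qed

theorem theorem4:
  fixes n :: nat and r :: "'a rel" and f :: "'a set \<Rightarrow> nat"
  assumes "2 \<le> n" and "is_omega n r"
  shows "\<exists>s \<in> Fpow (Field r).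
    2 ^ n - 1 \<le> card {{x, y} | x y. x \<in> Fpow (Field r) \<and> y \<in> Fpow (Field r) \<and>
                                x \<noteq> y \<and> x \<union> y = s \<and> f x = f y}"
proof -
  have "r \<le>o |Field r|"
    using card_of_Field_ordIso[OF is_omega_Card_order[OF assms(2)]]
    by (simp add: ordIso_iff_ordLeq)
  then obtain s where s: "s \<in> Fpow (Field r)" "2 * 2 ^ n \<le> card (mono_decomps f s) + 2"
    using many_mono_decomps[OF assms(2)] by blast
  have fin: "finite s" and sub: "s \<subseteq> Field r"
    using s(1) by (auto simp: Fpow_def)
  \<comment> \<open>Both parts are subsets of the finite set \<open>s\<close>, so membership in
    \<open>Fpow (Field r)\<close> is automatic.\<close>
  have "x \<in> Fpow (Field r) \<and> y \<in> Fpow (Field r) \<and> x \<noteq> y \<and> x \<union> y = s \<and> f x = f y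
    \<longleftrightarrow> x \<noteq> y \<and> x \<union> y = s \<and> f x = f y" for x y
    using fin sub by (auto simp: Fpow_def)
  then have "{{x, y} | x y. x \<in> Fpow (Field r) \<and> y \<in> Fpow (Field r) \<and>
                                x \<noteq> y \<and> x \<union> y = s \<and> f x = f y}
    = {{x, y} | x y. x \<noteq> y \<and> x \<union> y = s \<and> f x = f y}"
    by (simp only:)
  then show ?thesis
    using s card_mono_decomps_le_unordered[OF fin, of f] by (intro bexI[OF _ s(1)]) simp
qed

end
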